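(* Let $E,F$ be complex Banach spaces, $U$ an open subset of $E$, and $1<p_1\leq p_2\leq\infty$. If $f\in\mathcal{D}_{p_2}^{\mathcal{H}^\infty}(U,F)$, then $f\in\mathcal{D}_{p_1}^{\mathcal{H}^\infty}(U,F)$ and $d_{p_1}^{\mathcal{H}^\infty}(f)\leq d_{p_2}^{\mathcal{H}^\infty}(f)$.
   Context: For $1<p\leq\infty$, with conjugate index $p^*$ ($\infty^*=1$) and $B_X$ the closed unit ball of $X$, $\mathcal{D}_p^{\mathcal{H}^\infty}(U,F)$ (Cohen strongly $p$-summing holomorphic mappings) is the set of holomorphic $f\colon U\to F$ for which there is $C\geq0$ such that for all $n\in\mathbb{N}$, $\lambda_i\in\mathbb{C}$, $x_i\in U$, $y_i^*\in F^*$ ($1\le i\le n$), $\sum_{i=1}^n|\lambda_i||\langle y_i^*,f(x_i)\rangle|\leq C\|(\lambda_i)\|_{\ell_p^n}\sup_{y^{**}\in B_{F^{**}}}(\sum_i|y^{**}(y_i^* )|^{p^*})^{1/p^*}$, where $\|(\lambda_i)\|_{\ell_p^n}=(\sum_i|\lambda_i|^p)^{1/p}$ ($\max_i|\lambda_i|$ if $p=\infty$); $d_p^{\mathcal{H}^\infty}(f)$ is the infimum of such $C$. *)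

theory Defs
  imports "HOL-Analysis.Analysis"
begin

section \<open>Complex Banach spaces\<close>

text \<open>
  The distribution only has real normed spaces as type classes. A complex normed space is a
  real one with a compatible complex scalar multiplication, so that \<^const>\<open>has_derivative\<close>,
  \<^const>\<open>open\<close>, \<^const>\<open>onorm\<close> etc. are directly available.
\<close>

class complex_normed_vector = real_normed_vector +
  fixes scaleC :: "complex \<Rightarrow> 'a \<Rightarrow> 'a" (infixr "*\<^sub>C" 75)
  assumes scaleC_add_right: "c *\<^sub>C (x + y) = c *\<^sub>C x + c *\<^sub>C y"
    and scaleC_add_left: "(c + d) *\<^sub>C x = c *\<^sub>C x + d *\<^sub>C x"
    and scaleC_scaleC: "c *\<^sub>C d *\<^sub>C x = (c * d) *\<^sub>C x"
    and scaleC_of_real: "complex_of_real r *\<^sub>C x = r *\<^sub>R x"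
    and norm_scaleC: "norm (c *\<^sub>C x) = cmod c * norm x"

class complex_banach = complex_normed_vector + complete_space

instantiation complex :: complex_banach
begin

definition scaleC_complex :: "complex \<Rightarrow> complex \<Rightarrow> complex"
  where "scaleC_complex c x = c * x"

instance
  by standard (auto simp: scaleC_complex_def algebra_simps norm_mult scaleR_conv_of_real)

end

definition bounded_clinear :: "('a::complex_normed_vector \<Rightarrow> 'b::complex_normed_vector) \<Rightarrow> bool"
  where "bounded_clinear T \<longleftrightarrow> bounded_linear T \<and> (\<forall>c x. T (c *\<^sub>C x) = c *\<^sub>C T x)"


section \<open>The topological dual\<close>

text \<open>
  The dual is again a type in \<open>complex_normed_vector\<close>, so the construction iterates:
  \<open>'f cdual cdual\<close> is the bidual.
\<close>

typedef (overloaded) 'a cdual =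
  "{\<phi> :: 'a::complex_normed_vector \<Rightarrow> complex. bounded_clinear \<phi>}"
  morphisms cdual_apply Cdual
  by (rule exI[of _ "\<lambda>_. 0"]) (simp add: bounded_clinear_def scaleC_complex_def)

setup_lifting type_definition_cdual

lemma cdual_eqI: "(\<And>x. cdual_apply \<phi> x = cdual_apply \<psi> x) \<Longrightarrow> \<phi> = \<psi>"
  by transfer auto

lemma bounded_linear_cdual_apply: "bounded_linear (cdual_apply \<phi>)"
  by transfer (simp add: bounded_clinear_def)

instantiation cdual :: (complex_normed_vector) complex_normed_vector
begin

lift_definition norm_cdual :: "'a cdual \<Rightarrow> real" is onorm .

lift_definition zero_cdual :: "'a cdual" is "\<lambda>x. 0"
  by (simp add: bounded_clinear_def scaleC_complex_def)

lift_definition plus_cdual :: "'a cdual \<Rightarrow> 'a cdual \<Rightarrow> 'a cdual" is "\<lambda>\<phi> \<psi> x. \<phi> x + \<psi> x"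
  by (auto simp: bounded_clinear_def scaleC_complex_def algebra_simps intro: bounded_linear_add)

lift_definition minus_cdual :: "'a cdual \<Rightarrow> 'a cdual \<Rightarrow> 'a cdual" is "\<lambda>\<phi> \<psi> x. \<phi> x - \<psi> x"
  by (auto simp: bounded_clinear_def scaleC_complex_def algebra_simps intro: bounded_linear_sub)

lift_definition uminus_cdual :: "'a cdual \<Rightarrow> 'a cdual" is "\<lambda>\<phi> x. - \<phi> x"
  by (auto simp: bounded_clinear_def scaleC_complex_def intro: bounded_linear_minus)

lift_definition scaleR_cdual :: "real \<Rightarrow> 'a cdual \<Rightarrow> 'a cdual" is "\<lambda>r \<phi> x. r *\<^sub>R \<phi> x"
  by (auto simp: bounded_clinear_def scaleC_complex_def
      intro: bounded_linear_compose[OF bounded_linear_scaleR_right])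

lift_definition scaleC_cdual :: "complex \<Rightarrow> 'a cdual \<Rightarrow> 'a cdual" is "\<lambda>c \<phi> x. c * \<phi> x"
  by (auto simp: bounded_clinear_def scaleC_complex_def
      intro: bounded_linear_compose[OF bounded_linear_mult_right])

definition dist_cdual :: "'a cdual \<Rightarrow> 'a cdual \<Rightarrow> real"
  where "dist_cdual \<phi> \<psi> = norm (\<phi> - \<psi>)"

definition uniformity_cdual :: "('a cdual \<times> 'a cdual) filter"
  where "uniformity_cdual = (INF e\<in>{0 <..}. principal {(\<phi>, \<psi>). dist \<phi> \<psi> < e})"

definition open_cdual :: "'a cdual set \<Rightarrow> bool"
  where "open_cdual S \<longleftrightarrow> (\<forall>\<phi>\<in>S. \<forall>\<^sub>F (\<phi>', \<psi>) in uniformity. \<phi>' = \<phi> \<longrightarrow> \<psi> \<in> S)"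

definition sgn_cdual :: "'a cdual \<Rightarrow> 'a cdual"
  where "sgn_cdual \<phi> = inverse (norm \<phi>) *\<^sub>R \<phi>"

instance
proof
  fix \<phi> \<psi> \<theta> :: "'a cdual" and r s :: real and c d :: complex
  show "\<phi> + \<psi> + \<theta> = \<phi> + (\<psi> + \<theta>)" "\<phi> + \<psi> = \<psi> + \<phi>" "0 + \<phi> = \<phi>" "- \<phi> + \<phi> = 0" "\<phi> - \<psi> = \<phi> + - \<psi>"
    "r *\<^sub>R (\<phi> + \<psi>) = r *\<^sub>R \<phi> + r *\<^sub>R \<psi>" "(r + s) *\<^sub>R \<phi> = r *\<^sub>R \<phi> + s *\<^sub>R \<phi>"
    "r *\<^sub>R s *\<^sub>R \<phi> = (r * s) *\<^sub>R \<phi>" "1 *\<^sub>R \<phi> = \<phi>"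
    "c *\<^sub>C (\<phi> + \<psi>) = c *\<^sub>C \<phi> + c *\<^sub>C \<psi>" "(c + d) *\<^sub>C \<phi> = c *\<^sub>C \<phi> + d *\<^sub>C \<phi>"
    "c *\<^sub>C d *\<^sub>C \<phi> = (c * d) *\<^sub>C \<phi>" "complex_of_real r *\<^sub>C \<phi> = r *\<^sub>R \<phi>"
    by (transfer, simp add: algebra_simps scaleR_conv_of_real)+
  show "sgn \<phi> = inverse (norm \<phi>) *\<^sub>R \<phi>" by (simp add: sgn_cdual_def)
  show "dist \<phi> \<psi> = norm (\<phi> - \<psi>)" by (simp add: dist_cdual_def)
  show "(uniformity :: ('a cdual \<times> 'a cdual) filter)
      = (INF e\<in>{0 <..}. principal {(\<phi>, \<psi>). dist \<phi> \<psi> < e})"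
    by (simp add: uniformity_cdual_def)
  show "open S \<longleftrightarrow> (\<forall>\<phi>\<in>S. \<forall>\<^sub>F (\<phi>', \<psi>) in uniformity. \<phi>' = \<phi> \<longrightarrow> \<psi> \<in> S)" for S :: "'a cdual set"
    by (simp add: open_cdual_def)
  show "norm \<phi> = 0 \<longleftrightarrow> \<phi> = 0"
    by transfer (auto simp: bounded_clinear_def onorm_eq_0)
  show "norm (\<phi> + \<psi>) \<le> norm \<phi> + norm \<psi>"
    by transfer (auto simp: bounded_clinear_def onorm_triangle)
  show "norm (r *\<^sub>R \<phi>) = \<bar>r\<bar> * norm \<phi>"
    by transfer (auto simp: bounded_clinear_def onorm_scaleR)
  show "norm (c *\<^sub>C \<phi>) = cmod c * norm \<phi>"
  proof transfer
    fix c and \<phi> :: "'a \<Rightarrow> complex"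
    assume "bounded_clinear \<phi>"
    then have bl: "bounded_linear \<phi>" by (simp add: bounded_clinear_def)
    have "onorm (\<lambda>x. c * \<phi> x) = onorm (\<lambda>x. cmod c *\<^sub>R \<phi> x)"
      by (simp add: onorm_def norm_mult)
    also have "\<dots> = cmod c * onorm \<phi>" using onorm_scaleR[OF bl, of "cmod c"] by simp
    finally show "onorm (\<lambda>x. c * \<phi> x) = cmod c * onorm \<phi>" .
  qed
qed

end

lemma norm_cdual_apply: "cmod (cdual_apply \<phi> x) \<le> norm \<phi> * norm x"
  by transfer (auto simp: bounded_clinear_def onorm)


section \<open>Holomorphic mappings\<close>

text \<open>Complex Frechet differentiability at every point of the open set \<open>U\<close>.\<close>

definition holomorphic_map ::
    "'e::complex_normed_vector set \<Rightarrow> ('e \<Rightarrow> 'f::complex_normed_vector) \<Rightarrow> bool"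
  where "holomorphic_map U f \<longleftrightarrow>
    (\<forall>x\<in>U. \<exists>D. bounded_clinear D \<and> (f has_derivative D) (at x))"


section \<open>Cohen strongly p-summing holomorphic mappings\<close>

text \<open>The conjugate index of \<open>p \<in> (1,\<infinity>]\<close>, which always lies in \<open>[1,\<infinity>)\<close>.\<close>

definition conj_index :: "ereal \<Rightarrow> real"
  where "conj_index p = (if p = \<infinity> then 1 else real_of_ereal p / (real_of_ereal p - 1))"

lemma conj_index_sum:
  assumes "1 < p" "p \<noteq> \<infinity>"
  shows "1 / real_of_ereal p + 1 / conj_index p = 1"
  using assms by (cases p) (auto simp: conj_index_def field_simps)

definition lp_norm :: "ereal \<Rightarrow> nat \<Rightarrow> (nat \<Rightarrow> complex) \<Rightarrow> real"
  where "lp_norm p n l =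
    (if p = \<infinity> then (MAX i\<in>{1..n}. cmod (l i))
     else (\<Sum>i=1..n. cmod (l i) powr real_of_ereal p) powr (1 / real_of_ereal p))"

definition weak_lp_norm :: "real \<Rightarrow> nat \<Rightarrow> (nat \<Rightarrow> 'f::complex_normed_vector cdual) \<Rightarrow> real"
  where "weak_lp_norm q n y =
    (SUP \<phi> \<in> (cball 0 1 :: 'f cdual cdual set).
      (\<Sum>i=1..n. cmod (cdual_apply \<phi> (y i)) powr q) powr (1 / q))"

text \<open>The supremum is taken in the reals and over a bounded nonempty set.\<close>

lemma weak_lp_norm_bdd_above:
  fixes y :: "nat \<Rightarrow> 'f::complex_normed_vector cdual"
  assumes "0 < q"
  shows "bdd_above ((\<lambda>\<phi>. (\<Sum>i=1..n. cmod (cdual_apply \<phi> (y i)) powr q) powr (1 / q))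
    ` (cball 0 1 :: 'f cdual cdual set))"
proof (rule bdd_aboveI2)
  fix \<phi> :: "'f cdual cdual" assume "\<phi> \<in> cball 0 1"
  then have "norm \<phi> \<le> 1" by simp
  then have "cmod (cdual_apply \<phi> (y i)) \<le> norm (y i)" for i
    using order_trans[OF norm_cdual_apply[of \<phi> "y i"]] by (simp add: mult_left_le_one_le)
  then show "(\<Sum>i=1..n. cmod (cdual_apply \<phi> (y i)) powr q) powr (1 / q)
      \<le> (\<Sum>i=1..n. norm (y i) powr q) powr (1 / q)"
    using assms by (intro powr_mono2 sum_mono sum_nonneg) auto
qed

definition cohen_bound ::
    "ereal \<Rightarrow> 'e::complex_normed_vector set \<Rightarrow> ('e \<Rightarrow> 'f::complex_normed_vector) \<Rightarrow> real \<Rightarrow> bool"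
  where "cohen_bound p U f C \<longleftrightarrow>
    (\<forall>n\<ge>1. \<forall>(l :: nat \<Rightarrow> complex) (x :: nat \<Rightarrow> 'e) (y :: nat \<Rightarrow> 'f cdual).
      (\<forall>i\<in>{1..n}. x i \<in> U) \<longrightarrow>
      (\<Sum>i=1..n. cmod (l i) * cmod (cdual_apply (y i) (f (x i))))
        \<le> C * lp_norm p n l * weak_lp_norm (conj_index p) n y)"

definition cohen_hol ::
    "ereal \<Rightarrow> 'e::complex_normed_vector set \<Rightarrow> ('e \<Rightarrow> 'f::complex_normed_vector) set"
  where "cohen_hol p U = {f. holomorphic_map U f \<and> (\<exists>C\<ge>0. cohen_bound p U f C)}"

definition cohen_norm ::
    "ereal \<Rightarrow> 'e::complex_normed_vector set \<Rightarrow> ('e \<Rightarrow> 'f::complex_normed_vector) \<Rightarrow> real"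
  where "cohen_norm p U f = Inf {C. 0 \<le> C \<and> cohen_bound p U f C}"

end

theory Submission
  imports Defs
begin

text \<open>
  Each term \<open>\<bar>\<lambda>\<^sub>i\<bar> \<cdot> \<bar>y\<^sub>i\<^sup>*(f(x\<^sub>i))\<bar>\<close> of the sum to be estimated is unchanged when a factor of \<open>\<lambda>\<^sub>i\<close>
  is moved to \<open>y\<^sub>i\<^sup>*\<close>.
  To pass from \<open>p\<^sub>2\<close> to a smaller finite \<open>p\<^sub>1\<close>, split
  \<open>\<bar>\<lambda>\<^sub>i\<bar> = \<bar>\<lambda>\<^sub>i\<bar>\<^bsup>p\<^sub>1/p\<^sub>2\<^esup> \<cdot> \<bar>\<lambda>\<^sub>i\<bar>\<^bsup>1 - p\<^sub>1/p\<^sub>2\<^esup>\<close> and give the second factor to \<open>y\<^sub>i\<^sup>*\<close>. The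
  \<open>p\<^sub>2\<close>-norm of the first factors is \<open>S\<^bsup>1/p\<^sub>2\<^esup>\<close> with \<open>S = \<Sum>\<bar>\<lambda>\<^sub>i\<bar>\<^bsup>p\<^sub>1\<^esup>\<close>. Since
  \<open>1/p\<^sub>2\<^sup>* = (1/p\<^sub>1 - 1/p\<^sub>2) + 1/p\<^sub>1\<^sup>*\<close>, the three-exponent Hoelder inequality bounds the weak
  \<open>p\<^sub>2\<^sup>*\<close>-norm of the rescaled functionals by \<open>S\<^bsup>1/p\<^sub>1 - 1/p\<^sub>2\<^esup>\<close> times the weak
  \<open>p\<^sub>1\<^sup>*\<close>-norm of the original ones. The powers of \<open>S\<close> multiply to \<open>S\<^bsup>1/p\<^sub>1\<^esup>\<close>, the
  \<open>p\<^sub>1\<close>-norm of \<open>(\<lambda>\<^sub>i)\<close>. Hence every constant that is admissible for \<open>p\<^sub>2\<close> is admissible for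
  \<open>p\<^sub>1\<close>, which gives both the inclusion and the comparison of the infima.
\<close>

text \<open>
  After dividing \<open>A\<close> and \<open>B\<close> by their sums, Young's inequality applies to each term and its
  right-hand sides add up to \<open>\<alpha> + \<beta> = 1\<close>.
\<close>

lemma Hoelder_sum_weighted:
  fixes A B :: "'i \<Rightarrow> real"
  assumes "finite I" and A: "\<And>i. i \<in> I \<Longrightarrow> 0 \<le> A i" and B: "\<And>i. i \<in> I \<Longrightarrow> 0 \<le> B i"
    and \<alpha>: "0 \<le> \<alpha>" and \<beta>: "0 \<le> \<beta>" and "\<alpha> + \<beta> = 1"
  shows "(\<Sum>i\<in>I. A i powr \<alpha> * B i powr \<beta>) \<le> (\<Sum>i\<in>I. A i) powr \<alpha> * (\<Sum>i\<in>I. B i) powr \<beta>"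
proof (cases "sum A I = 0 \<or> sum B I = 0")
  case True
  then have "A i powr \<alpha> * B i powr \<beta> = 0" if "i \<in> I" for i
    using that assms by (auto simp: sum_nonneg_eq_0_iff)
  then have "(\<Sum>i\<in>I. A i powr \<alpha> * B i powr \<beta>) = 0" by (intro sum.neutral ballI)
  then show ?thesis by (simp only: mult_nonneg_nonneg powr_ge_zero)
next
  case False
  define a b where "a = sum A I" and "b = sum B I"
  have pos: "0 < a" "0 < b"
    using False A B by (auto simp: a_def b_def less_le sum_nonneg)
  have "A i powr \<alpha> * B i powr \<beta> \<le> (a powr \<alpha> * b powr \<beta>) * (\<alpha> * (A i / a) + \<beta> * (B i / b))"
    if "i \<in> I" for i
  proof (cases "A i = 0 \<or> B i = 0")
    case True
    have "0 \<le> (a powr \<alpha> * b powr \<beta>) * (\<alpha> * (A i / a) + \<beta> * (B i / b))"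
      using pos \<alpha> \<beta> A[OF that] B[OF that] by simp
    then show ?thesis using True by auto
  next
    case False
    then have "(A i / a) powr \<alpha> * (B i / b) powr \<beta> \<le> \<alpha> * (A i / a) + \<beta> * (B i / b)"
      using assms pos A[OF that] B[OF that] by (intro Youngs_inequality_0) auto
    then have "(a powr \<alpha> * b powr \<beta>) * ((A i / a) powr \<alpha> * (B i / b) powr \<beta>)
        \<le> (a powr \<alpha> * b powr \<beta>) * (\<alpha> * (A i / a) + \<beta> * (B i / b))"
      by (intro mult_left_mono) auto
    then show ?thesis using pos by (simp add: powr_divide)
  qed
  then have "(\<Sum>i\<in>I. A i powr \<alpha> * B i powr \<beta>)
      \<le> (\<Sum>i\<in>I. (a powr \<alpha> * b powr \<beta>) * (\<alpha> * (A i / a) + \<beta> * (B i / b)))"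
    by (rule sum_mono)
  also have "\<dots> = (a powr \<alpha> * b powr \<beta>) * (\<alpha> * (sum A I / a) + \<beta> * (sum B I / b))"
    by (simp only: sum_distrib_left[symmetric] sum.distrib sum_divide_distrib)
  also have "\<dots> = a powr \<alpha> * b powr \<beta>"
    using pos \<open>\<alpha> + \<beta> = 1\<close> by (simp flip: a_def b_def)
  finally show ?thesis by (simp add: a_def b_def)
qed

lemma Hoelder_sum_three_exponents:
  fixes a b :: "'i \<Rightarrow> real"
  assumes "finite I" and "\<And>i. i \<in> I \<Longrightarrow> 0 \<le> a i" and "\<And>i. i \<in> I \<Longrightarrow> 0 \<le> b i"
    and "0 < r" "0 < u" "0 < v" and uv: "1 / r = 1 / u + 1 / v"
  shows "(\<Sum>i\<in>I. (a i * b i) powr r) powr (1 / r)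
    \<le> (\<Sum>i\<in>I. a i powr u) powr (1 / u) * (\<Sum>i\<in>I. b i powr v) powr (1 / v)"
proof -
  have "r / u + r / v = r * (1 / r)" by (simp add: uv algebra_simps)
  then have conj: "r / u + r / v = 1" using \<open>0 < r\<close> by simp
  have "(\<Sum>i\<in>I. (a i * b i) powr r)
      = (\<Sum>i\<in>I. (a i powr u) powr (r / u) * (b i powr v) powr (r / v))"
    using assms by (intro sum.cong) (auto simp: powr_mult powr_powr)
  also have "\<dots> \<le> (\<Sum>i\<in>I. a i powr u) powr (r / u) * (\<Sum>i\<in>I. b i powr v) powr (r / v)"
    using assms conj by (intro Hoelder_sum_weighted) auto
  finally have "(\<Sum>i\<in>I. (a i * b i) powr r) powr (1 / r) \<le>
      ((\<Sum>i\<in>I. a i powr u) powr (r / u) * (\<Sum>i\<in>I. b i powr v) powr (r / v)) powr (1 / r)"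
    using \<open>0 < r\<close> by (intro powr_mono2 sum_nonneg) auto
  also have "\<dots> = (\<Sum>i\<in>I. a i powr u) powr (1 / u) * (\<Sum>i\<in>I. b i powr v) powr (1 / v)"
    using \<open>0 < r\<close> by (simp add: powr_mult powr_powr)
  finally show ?thesis .
qed

lemma cdual_apply_scaleC: "cdual_apply \<phi> (c *\<^sub>C x) = c * cdual_apply \<phi> x"
  using cdual_apply[of \<phi>] by (simp add: bounded_clinear_def scaleC_complex_def)

lemma weak_lp_norm_upper:
  fixes y :: "nat \<Rightarrow> 'f::complex_normed_vector cdual"
  assumes "0 < q" and "\<phi> \<in> (cball 0 1 :: 'f cdual cdual set)"
  shows "(\<Sum>i=1..n. cmod (cdual_apply \<phi> (y i)) powr q) powr (1 / q) \<le> weak_lp_norm q n y"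
  unfolding weak_lp_norm_def
  using cSUP_upper[OF assms(2) weak_lp_norm_bdd_above[OF assms(1)]] .

lemma weak_lp_norm_nonneg: "0 < q \<Longrightarrow> 0 \<le> weak_lp_norm q n y"
  by (rule order_trans[OF _ weak_lp_norm_upper[of q 0]]) auto

text \<open>
  The three-exponent inequality applies at each \<open>\<phi>\<close> of the bidual ball, and the factor coming from the
  scalars does not depend on \<open>\<phi>\<close>, so the estimate survives the supremum.
\<close>

lemma weak_lp_norm_scaleC_le:
  fixes y :: "nat \<Rightarrow> 'f::complex_normed_vector cdual" and c :: "nat \<Rightarrow> complex"
  assumes "0 < r" "0 < u" "0 < v" "1 / r = 1 / u + 1 / v"
  shows "weak_lp_norm r n (\<lambda>i. c i *\<^sub>C y i)
    \<le> (\<Sum>i=1..n. cmod (c i) powr u) powr (1 / u) * weak_lp_norm v n y"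
  unfolding weak_lp_norm_def[of r]
proof (rule cSUP_least)
  fix \<phi> :: "'f cdual cdual" assume \<phi>: "\<phi> \<in> cball 0 1"
  have "(\<Sum>i=1..n. cmod (cdual_apply \<phi> (c i *\<^sub>C y i)) powr r) powr (1 / r)
      \<le> (\<Sum>i=1..n. cmod (c i) powr u) powr (1 / u)
        * (\<Sum>i=1..n. cmod (cdual_apply \<phi> (y i)) powr v) powr (1 / v)"
    unfolding cdual_apply_scaleC norm_mult
    by (rule Hoelder_sum_three_exponents) (use assms in auto)
  also have "\<dots> \<le> (\<Sum>i=1..n. cmod (c i) powr u) powr (1 / u) * weak_lp_norm v n y"
    using assms \<phi> by (intro mult_left_mono weak_lp_norm_upper) auto
  finally show "(\<Sum>i=1..n. cmod (cdual_apply \<phi> (c i *\<^sub>C y i)) powr r) powr (1 / r) \<le> \<dots>" .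
qed simp

lemma conj_index_pos: "1 < p \<Longrightarrow> 0 < conj_index p"
  by (cases p) (auto simp: conj_index_def)

text \<open>
  The case \<open>p = \<infinity>\<close> is covered because \<open>real_of_ereal \<infinity> = 0\<close> and division by zero gives zero,
  which is the intended value of \<open>1 / \<infinity>\<close>.
\<close>

lemma inverse_conj_index: "1 < p \<Longrightarrow> 1 / conj_index p = 1 - 1 / real_of_ereal p"
  by (cases p) (auto simp: conj_index_def field_simps)

text \<open>
  For finite \<open>p\<close> both sides agree. For \<open>p = \<infinity>\<close> the exponent on both sides is \<open>0\<close>, and because
  \<open>0 powr 0 = 0\<close> the vector on the left is the indicator of the support of \<open>l\<close> and the right-hand
  side is \<open>0\<close> or \<open>1\<close> according to whether this support is empty.
\<close>

lemma lp_norm_powr_le: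
  fixes l :: "nat \<Rightarrow> complex"
  assumes "1 < p" "1 \<le> n" "0 < r"
  shows "lp_norm p n (\<lambda>i. complex_of_real (cmod (l i) powr (r / real_of_ereal p)))
    \<le> (\<Sum>i=1..n. cmod (l i) powr r) powr (1 / real_of_ereal p)"
proof (cases "p = \<infinity>")
  case True
  have "cmod (l i) powr 0 \<le> (\<Sum>j=1..n. cmod (l j) powr r) powr 0" if "i \<in> {1..n}" for i
  proof (cases "l i = 0")
    case False
    then have "0 < (\<Sum>j=1..n. cmod (l j) powr r)"
      using that by (intro sum_pos2[of _ i]) auto
    then show ?thesis by simp
  qed simp
  then have "(MAX i\<in>{1..n}. cmod (l i) powr 0) \<le> (\<Sum>j=1..n. cmod (l j) powr r) powr 0"
    using \<open>1 \<le> n\<close> by (intro Max.boundedI) (auto simp del: powr_zero_eq_one)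
  then show ?thesis using True by (simp add: lp_norm_def del: powr_zero_eq_one)
next
  case False
  with \<open>1 < p\<close> have "real_of_ereal p \<noteq> 0" by (cases p) auto
  then show ?thesis using False by (simp add: lp_norm_def powr_powr)
qed

text \<open>
  If \<open>p1 < p2\<close>, then \<open>p1\<close> is finite, and \<open>t\<close> below is \<open>1 / p2\<close>, with value \<open>0\<close> at infinity. The
  scalars \<open>m\<close> and \<open>c\<close> are the two factors of \<open>\<bar>l\<bar>\<close>; \<open>c\<close> is absorbed into the functionals.
\<close>

lemma cohen_bound_antimono:
  fixes U :: "'e::complex_normed_vector set" and f :: "'e \<Rightarrow> 'f::complex_normed_vector"
  assumes "1 < p1" "p1 \<le> p2" "0 \<le> C" and bound: "cohen_bound p2 U f C"
  shows "cohen_bound p1 U f C"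
proof (cases "p1 = p2")
  case True
  then show ?thesis using bound by simp
next
  case False
  define p t where "p = real_of_ereal p1" and "t = 1 / real_of_ereal p2"
  have "p1 < p2" "1 < p2" using assms False by auto
  have "p1 \<noteq> \<infinity>" using \<open>p1 < p2\<close> by auto
  have "1 < p" using \<open>1 < p1\<close> \<open>p1 \<noteq> \<infinity>\<close> by (cases p1) (auto simp: p_def)
  have "t < 1 / p"
    using \<open>1 < p1\<close> \<open>p1 < p2\<close> by (cases p1; cases p2) (auto simp: p_def t_def field_simps)
  then have s: "0 < 1 / p - t" "p * t < 1" using \<open>1 < p\<close> by (auto simp: field_simps)
  show ?thesis
    unfolding cohen_bound_def
  proof (intro allI impI)
    fix n :: nat and l :: "nat \<Rightarrow> complex" and x :: "nat \<Rightarrow> 'e" and y :: "nat \<Rightarrow> 'f cdual"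
    assume "1 \<le> n" and x: "\<forall>i\<in>{1..n}. x i \<in> U"
    define S where "S = (\<Sum>i=1..n. cmod (l i) powr p)"
    define m c where "m = (\<lambda>i. complex_of_real (cmod (l i) powr (p * t)))"
      and "c = (\<lambda>i. complex_of_real (cmod (l i) powr (1 - p * t)))"
    have split: "cmod (m i) * cmod (c i) = cmod (l i)" for i
      by (simp add: m_def c_def flip: powr_add)
    have m: "lp_norm p2 n m \<le> S powr t"
      using lp_norm_powr_le[OF \<open>1 < p2\<close> \<open>1 \<le> n\<close>, of p l] \<open>1 < p\<close>
      by (simp add: m_def S_def t_def)
    \<comment> \<open>The exponent \<open>u = 1 / (1/p - t)\<close> satisfies \<open>(1 - p t) u = p\<close>.\<close>
    have "weak_lp_norm (conj_index p2) n (\<lambda>i. c i *\<^sub>C y i)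
        \<le> (\<Sum>i=1..n. cmod (c i) powr (1 / (1 / p - t))) powr (1 / (1 / (1 / p - t)))
          * weak_lp_norm (conj_index p1) n y"
      using s \<open>1 < p1\<close> \<open>1 < p2\<close>
      by (intro weak_lp_norm_scaleC_le)
        (auto simp: conj_index_pos inverse_conj_index simp flip: p_def t_def)
    also have "(1 - p * t) * (1 / (1 / p - t)) = p"
      using \<open>1 < p\<close> s by (simp add: field_simps)
    then have "(\<Sum>i=1..n. cmod (c i) powr (1 / (1 / p - t))) = S"
      by (simp add: c_def S_def powr_powr)
    finally have w: "weak_lp_norm (conj_index p2) n (\<lambda>i. c i *\<^sub>C y i)
        \<le> S powr (1 / p - t) * weak_lp_norm (conj_index p1) n y"
      by simp
    have "(\<Sum>i=1..n. cmod (l i) * cmod (cdual_apply (y i) (f (x i))))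
        = (\<Sum>i=1..n. cmod (m i) * cmod (cdual_apply (c i *\<^sub>C y i) (f (x i))))"
      by (simp add: scaleC_cdual.rep_eq norm_mult split flip: mult.assoc)
    also have "\<dots> \<le> C * lp_norm p2 n m * weak_lp_norm (conj_index p2) n (\<lambda>i. c i *\<^sub>C y i)"
      using bound[unfolded cohen_bound_def, rule_format, of n x m "\<lambda>i. c i *\<^sub>C y i"]
        \<open>1 \<le> n\<close> x by simp
    also have "\<dots> \<le> C * S powr t * (S powr (1 / p - t) * weak_lp_norm (conj_index p1) n y)"
      using m w \<open>0 \<le> C\<close> \<open>1 < p2\<close>
      by (intro mult_mono mult_left_mono weak_lp_norm_nonneg conj_index_pos) auto
    also have "\<dots> = C * (S powr t * S powr (1 / p - t)) * weak_lp_norm (conj_index p1) n y"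
      by (simp only: mult.assoc)
    also have "S powr t * S powr (1 / p - t) = lp_norm p1 n l"
      using \<open>p1 \<noteq> \<infinity>\<close> by (simp add: lp_norm_def S_def p_def flip: powr_add)
    finally show "(\<Sum>i=1..n. cmod (l i) * cmod (cdual_apply (y i) (f (x i))))
        \<le> C * lp_norm p1 n l * weak_lp_norm (conj_index p1) n y" .
  qed
qed

theorem corollary5p7:
  fixes U :: "'e::complex_banach set"
    and f :: "'e \<Rightarrow> 'f::complex_banach"
    and p1 p2 :: ereal
  assumes "open U"
    and "1 < p1" and "p1 \<le> p2" and "p2 \<le> \<infinity>"
    and "f \<in> cohen_hol p2 U"
  shows "f \<in> cohen_hol p1 U \<and> cohen_norm p1 U f \<le> cohen_norm p2 U f"
proof
  have sub: "{C. 0 \<le> C \<and> cohen_bound p2 U f C} \<subseteq> {C. 0 \<le> C \<and> cohen_bound p1 U f C}"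
    using assms cohen_bound_antimono by blast
  then show "f \<in> cohen_hol p1 U"
    using assms(5) by (auto simp: cohen_hol_def)
  show "cohen_norm p1 U f \<le> cohen_norm p2 U f"
    unfolding cohen_norm_def
  proof (rule cInf_superset_mono)
    show "{C. 0 \<le> C \<and> cohen_bound p2 U f C} \<noteq> {}"
      using assms(5) by (auto simp: cohen_hol_def)
    show "bdd_below {C. 0 \<le> C \<and> cohen_bound p1 U f C}"
      by (rule bdd_belowI[of _ 0]) simp
  qed (rule sub)
qed

end
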